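(* Let $\mathbb{F}$ be a field, $E$ a vector space over $\mathbb{F}$ with a symmetric bilinear form $b\colon E\times E\to\mathbb{F}$, and let $\alpha\in\mathbb{F}$ with $\alpha\notin\{0,1\}$ and $\alpha\ne\frac12$ (i.e. $2\alpha\neq 1$). Let $A=S(b,\alpha)$ be the split spin factor algebra. Then: (1) $z_1$ and $z_2$ are primitive axes of Jordan type $\alpha$ and $1-\alpha$, respectively. (2) Suppose $\mathrm{char}(\mathbb{F})\neq 2$. For every $e\in E$ with $b(e,e)=1$, the element (family (a)) $\tfrac12\left(e+\alpha z_1+(\alpha+1)z_2\right)$ is a primitive axis of Monster type $(\alpha,\frac12)$, and the element (family (b)) $\tfrac12\left(e+(2-\alpha)z_1+(1-\alpha)z_2\right)$ is a primitive axis of Monster type $(1-\alpha,\frac12)$.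
   Context: Algebras are commutative, not necessarily associative. The split spin factor $S(b,\alpha)$ is the commutative algebra on the vector space $E\oplus\mathbb{F}z_1\oplus\mathbb{F}z_2$ with multiplication $z_1^2=z_1$, $z_2^2=z_2$, $z_1z_2=0$, $ez_1=\alpha e$, $ez_2=(1-\alpha)e$, $ef=-b(e,f)z$ for all $e,f\in E$, where $z:=\alpha(\alpha-2)z_1+(\alpha-1)(\alpha+1)z_2$. For an element $a$ of a commutative algebra $A$ over $\mathbb{F}$ and $\lambda\in\mathbb{F}$ put $A_\lambda(a)=\{v\in A: av=\lambda v\}$ (possibly zero), and for $N\subseteq\mathbb{F}$ put $A_N(a)=\bigoplus_{\nu\in N}A_\nu(a)$. A fusion law is a set $\mathcal{F}\subseteq\mathbb{F}$ containing $1$ with a symmetric map $\ast\colon\mathcal{F}\times\mathcal{F}\to 2^{\mathcal{F}}$. An $\mathcal{F}$-axis is a non-zero idempotent $a\in A$ such that $A=\bigoplus_{\lambda\in\mathcal{F}}A_\lambda(a)$ and $A_\lambda(a)A_\mu(a)\subseteq A_{\lambda\ast\mu}(a)$ for all $\lambda,\mu\in\mathcal{F}$. It is primitive if $A_1(a)=\mathbb{F}a$. The fusion law of Monster type $(\alpha,\beta)$ is the symmetric law on $\{1,0,\alpha,\beta\}$ (four distinct elements of $\mathbb F$) with $1\ast1=\{1\}$, $1\ast0=\emptyset$, $0\ast0=\{0\}$, $1\ast\alpha=0\ast\alpha=\{\alpha\}$, $\alpha\ast\alpha=\{1,0\}$, $1\ast\beta=0\ast\beta=\alpha\ast\beta=\{\beta\}$,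 $\beta\ast\beta=\{1,0,\alpha\}$. The fusion law of Jordan type $\alpha$ is its restriction to $\{1,0,\alpha\}$. An axis of Monster type $(\alpha,\beta)$ (resp. Jordan type $\alpha$) is an $\mathcal{F}$-axis for the corresponding law $\mathcal{F}$. *)

theory Defs
  imports Complex_Main "HOL-Library.Product_Plus"
begin

section \<open>Commutative non-associative algebras and axes\<close>

text \<open>
  An algebra over the field \<open>'f\<close> is given by a scalar multiplication \<open>scale\<close> and a product
  \<open>mult\<close> on the whole type \<open>'a\<close>.
\<close>

locale comm_nonassoc_algebra =
  vector_space scale for scale :: "'f::field \<Rightarrow> 'a::ab_group_add \<Rightarrow> 'a" +
  fixes mult :: "'a \<Rightarrow> 'a \<Rightarrow> 'a"
  assumes mult_commute: "mult u v = mult v u"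
    and mult_add_left: "mult (u + v) w = mult u w + mult v w"
    and mult_scale_left: "mult (scale c u) w = scale c (mult u w)"

definition eigenspace ::
    "('f::field \<Rightarrow> 'a::ab_group_add \<Rightarrow> 'a) \<Rightarrow> ('a \<Rightarrow> 'a \<Rightarrow> 'a) \<Rightarrow> 'a \<Rightarrow> 'f \<Rightarrow> 'a set" where
  "eigenspace scale mult a \<nu> = {v. mult a v = scale \<nu> v}"

text \<open>
  The sum of the eigenspaces for the elements of \<open>N\<close>; it is \<open>{0}\<close> for \<open>N = {}\<close>.  That it is direct
  is expressed separately by \<open>eigenspaces_independent\<close>.
\<close>

definition eigenspace_sum ::
    "('f::field \<Rightarrow> 'a::ab_group_add \<Rightarrow> 'a) \<Rightarrow> ('a \<Rightarrow> 'a \<Rightarrow> 'a) \<Rightarrow> 'a \<Rightarrow> 'f set \<Rightarrow> 'a set" where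
  "eigenspace_sum scale mult a N =
     {\<Sum>\<nu>\<in>S. g \<nu> | S g. finite S \<and> S \<subseteq> N \<and> (\<forall>\<nu>\<in>S. g \<nu> \<in> eigenspace scale mult a \<nu>)}"

definition eigenspaces_independent ::
    "('f::field \<Rightarrow> 'a::ab_group_add \<Rightarrow> 'a) \<Rightarrow> ('a \<Rightarrow> 'a \<Rightarrow> 'a) \<Rightarrow> 'a \<Rightarrow> 'f set \<Rightarrow> bool" where
  "eigenspaces_independent scale mult a N \<longleftrightarrow>
     (\<forall>S g. finite S \<and> S \<subseteq> N \<and> (\<forall>\<nu>\<in>S. g \<nu> \<in> eigenspace scale mult a \<nu>) \<and> (\<Sum>\<nu>\<in>S. g \<nu>) = 0
        \<longrightarrow> (\<forall>\<nu>\<in>S. g \<nu> = 0))"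

text \<open>
  The values of \<open>star\<close> outside \<open>F \<times> F\<close> are irrelevant.
\<close>

definition fusion_law :: "'f::field set \<Rightarrow> ('f \<Rightarrow> 'f \<Rightarrow> 'f set) \<Rightarrow> bool" where
  "fusion_law F star \<longleftrightarrow>
     1 \<in> F \<and> (\<forall>\<kappa>\<in>F. \<forall>\<mu>\<in>F. star \<kappa> \<mu> \<subseteq> F \<and> star \<kappa> \<mu> = star \<mu> \<kappa>)"

definition fusion_axis ::
    "('f::field \<Rightarrow> 'a::ab_group_add \<Rightarrow> 'a) \<Rightarrow> ('a \<Rightarrow> 'a \<Rightarrow> 'a) \<Rightarrow>
     'f set \<Rightarrow> ('f \<Rightarrow> 'f \<Rightarrow> 'f set) \<Rightarrow> 'a \<Rightarrow> bool" where
  "fusion_axis scale mult F star a \<longleftrightarrow>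
     fusion_law F star \<and>
     a \<noteq> 0 \<and> mult a a = a \<and>
     eigenspace_sum scale mult a F = UNIV \<and> eigenspaces_independent scale mult a F \<and>
     (\<forall>\<kappa>\<in>F. \<forall>\<mu>\<in>F. \<forall>u\<in>eigenspace scale mult a \<kappa>. \<forall>v\<in>eigenspace scale mult a \<mu>.
        mult u v \<in> eigenspace_sum scale mult a (star \<kappa> \<mu>))"

definition primitive ::
    "('f::field \<Rightarrow> 'a::ab_group_add \<Rightarrow> 'a) \<Rightarrow> ('a \<Rightarrow> 'a \<Rightarrow> 'a) \<Rightarrow> 'a \<Rightarrow> bool" where
  "primitive scale mult a \<longleftrightarrow> eigenspace scale mult a 1 = range (\<lambda>c. scale c a)"


section \<open>Jordan and Monster type\<close>

definition jordan_star :: "'f::field \<Rightarrow> 'f \<Rightarrow> 'f \<Rightarrow> 'f set" where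
  "jordan_star \<alpha> \<kappa> \<mu> =
     (if \<kappa> = 1 \<and> \<mu> = 1 then {1}
      else if {\<kappa>, \<mu>} = {1, 0} then {}
      else if \<kappa> = 0 \<and> \<mu> = 0 then {0}
      else if {\<kappa>, \<mu>} = {1, \<alpha>} \<or> {\<kappa>, \<mu>} = {0, \<alpha>} then {\<alpha>}
      else if \<kappa> = \<alpha> \<and> \<mu> = \<alpha> then {1, 0}
      else {})"

text \<open>
  The Jordan law of type \<open>\<alpha>\<close> is the restriction of the Monster law of type \<open>(\<alpha>, \<beta>)\<close>.  It is the
  primary definition here because a small field need not contain a fourth element \<open>\<beta>\<close>.
\<close>

definition monster_star :: "'f::field \<Rightarrow> 'f \<Rightarrow> 'f \<Rightarrow> 'f \<Rightarrow> 'f set" where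
  "monster_star \<alpha> \<beta> \<kappa> \<mu> =
     (if \<kappa> = \<beta> \<and> \<mu> = \<beta> then {1, 0, \<alpha>}
      else if \<kappa> = \<beta> \<or> \<mu> = \<beta> then {\<beta>}
      else jordan_star \<alpha> \<kappa> \<mu>)"

lemma monster_star_table:
  assumes "distinct [1, 0, \<alpha>, \<beta>]"
  shows "monster_star \<alpha> \<beta> 1 1 = {1}" "monster_star \<alpha> \<beta> 1 0 = {}" "monster_star \<alpha> \<beta> 0 0 = {0}"
    "monster_star \<alpha> \<beta> 1 \<alpha> = {\<alpha>}" "monster_star \<alpha> \<beta> 0 \<alpha> = {\<alpha>}" "monster_star \<alpha> \<beta> \<alpha> \<alpha> = {1, 0}"
    "monster_star \<alpha> \<beta> 1 \<beta> = {\<beta>}" "monster_star \<alpha> \<beta> 0 \<beta> = {\<beta>}" "monster_star \<alpha> \<beta> \<alpha> \<beta> = {\<beta>}"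
    "monster_star \<alpha> \<beta> \<beta> \<beta> = {1, 0, \<alpha>}"
    "monster_star \<alpha> \<beta> \<kappa> \<mu> = monster_star \<alpha> \<beta> \<mu> \<kappa>"
proof -
  have "\<alpha> \<noteq> 0" "\<alpha> \<noteq> 1" "\<beta> \<noteq> 0" "\<beta> \<noteq> 1" "\<beta> \<noteq> \<alpha>"
    and "0 \<noteq> \<alpha>" "1 \<noteq> \<alpha>" "0 \<noteq> \<beta>" "1 \<noteq> \<beta>" "\<alpha> \<noteq> \<beta>"
    using assms by auto
  then show "monster_star \<alpha> \<beta> 1 1 = {1}" "monster_star \<alpha> \<beta> 1 0 = {}" "monster_star \<alpha> \<beta> 0 0 = {0}"
    "monster_star \<alpha> \<beta> 1 \<alpha> = {\<alpha>}" "monster_star \<alpha> \<beta> 0 \<alpha> = {\<alpha>}" "monster_star \<alpha> \<beta> \<alpha> \<alpha> = {1, 0}"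
    "monster_star \<alpha> \<beta> 1 \<beta> = {\<beta>}" "monster_star \<alpha> \<beta> 0 \<beta> = {\<beta>}" "monster_star \<alpha> \<beta> \<alpha> \<beta> = {\<beta>}"
    "monster_star \<alpha> \<beta> \<beta> \<beta> = {1, 0, \<alpha>}"
    by (simp_all add: monster_star_def jordan_star_def doubleton_eq_iff)
  show "monster_star \<alpha> \<beta> \<kappa> \<mu> = monster_star \<alpha> \<beta> \<mu> \<kappa>"
    by (simp add: monster_star_def jordan_star_def insert_commute[of \<kappa> \<mu>] conj_commute disj_commute)
qed

definition jordan_axis ::
    "('f::field \<Rightarrow> 'a::ab_group_add \<Rightarrow> 'a) \<Rightarrow> ('a \<Rightarrow> 'a \<Rightarrow> 'a) \<Rightarrow> 'f \<Rightarrow> 'a \<Rightarrow> bool" where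
  "jordan_axis scale mult \<alpha> a \<longleftrightarrow>
     distinct [1, 0, \<alpha>] \<and> fusion_axis scale mult {1, 0, \<alpha>} (jordan_star \<alpha>) a"

definition monster_axis ::
    "('f::field \<Rightarrow> 'a::ab_group_add \<Rightarrow> 'a) \<Rightarrow> ('a \<Rightarrow> 'a \<Rightarrow> 'a) \<Rightarrow> 'f \<Rightarrow> 'f \<Rightarrow> 'a \<Rightarrow> bool" where
  "monster_axis scale mult \<alpha> \<beta> a \<longleftrightarrow>
     distinct [1, 0, \<alpha>, \<beta>] \<and> fusion_axis scale mult {1, 0, \<alpha>, \<beta>} (monster_star \<alpha> \<beta>) a"


section \<open>The split spin factor\<close>

definition symmetric_bilinear_form ::
    "('f::field \<Rightarrow> 'e::ab_group_add \<Rightarrow> 'e) \<Rightarrow> ('e \<Rightarrow> 'e \<Rightarrow> 'f) \<Rightarrow> bool" where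
  "symmetric_bilinear_form scale b \<longleftrightarrow>
     (\<forall>e f. b e f = b f e) \<and>
     (\<forall>e. Vector_Spaces.linear scale (*) (b e)) \<and>
     (\<forall>f. Vector_Spaces.linear scale (*) (\<lambda>e. b e f))"

text \<open>
  The triple \<open>(e, x, y)\<close> represents \<open>e + x z\<^sub>1 + y z\<^sub>2\<close>; addition is componentwise.
\<close>

definition ssf_scale ::
    "('f::field \<Rightarrow> 'e::ab_group_add \<Rightarrow> 'e) \<Rightarrow> 'f \<Rightarrow> 'e \<times> 'f \<times> 'f \<Rightarrow> 'e \<times> 'f \<times> 'f" where
  "ssf_scale scale c = (\<lambda>(e, x, y). (scale c e, c * x, c * y))"

definition ssf_emb :: "'e \<Rightarrow> 'e \<times> 'f::field \<times> 'f" where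
  "ssf_emb e = (e, 0, 0)"

definition ssf_z1 :: "'e::ab_group_add \<times> 'f::field \<times> 'f" where
  "ssf_z1 = (0, 1, 0)"

definition ssf_z2 :: "'e::ab_group_add \<times> 'f::field \<times> 'f" where
  "ssf_z2 = (0, 0, 1)"

definition ssf_z ::
    "('f::field \<Rightarrow> 'e::ab_group_add \<Rightarrow> 'e) \<Rightarrow> 'f \<Rightarrow> 'e \<times> 'f \<times> 'f" where
  "ssf_z scale \<alpha> =
     ssf_scale scale (\<alpha> * (\<alpha> - 2)) ssf_z1 + ssf_scale scale ((\<alpha> - 1) * (\<alpha> + 1)) ssf_z2"

text \<open>
  The bilinear extension of the defining products of \<open>S(b, \<alpha>)\<close>; see \<open>ssf_mult_relations\<close>.
\<close>

definition ssf_mult ::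
    "('f::field \<Rightarrow> 'e::ab_group_add \<Rightarrow> 'e) \<Rightarrow> ('e \<Rightarrow> 'e \<Rightarrow> 'f) \<Rightarrow> 'f \<Rightarrow>
     'e \<times> 'f \<times> 'f \<Rightarrow> 'e \<times> 'f \<times> 'f \<Rightarrow> 'e \<times> 'f \<times> 'f" where
  "ssf_mult scale b \<alpha> = (\<lambda>(e, x, y) (f, u, v).
     ssf_scale scale (x * u) ssf_z1 + ssf_scale scale (y * v) ssf_z2
     + ssf_emb (scale (\<alpha> * u + (1 - \<alpha>) * v) e + scale (\<alpha> * x + (1 - \<alpha>) * y) f)
     + ssf_scale scale (- b e f) (ssf_z scale \<alpha>))"

lemma symmetric_bilinear_formD:
  assumes "symmetric_bilinear_form scale b"
  shows "vector_space scale" "b e f = b f e" "b (e + e') f = b e f + b e' f"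
    "b (scale c e) f = c * b e f" "b 0 f = 0" "b e 0 = 0"
proof -
  have lin: "Vector_Spaces.linear scale (*) (\<lambda>e. b e f)" for f
    using assms by (simp add: symmetric_bilinear_form_def)
  show vs: "vector_space scale"
    using lin[of 0] by (simp add: Vector_Spaces.linear_def)
  show sym: "b e f = b f e" for e f
    using assms by (simp add: symmetric_bilinear_form_def)
  show add: "b (e + e') f = b e f + b e' f" for e e' f
    using lin[of f]
    by (simp add: Vector_Spaces.linear_def module_hom_def module_hom_axioms_def)
  show "b (scale c e) f = c * b e f"
    using lin[of f]
    by (simp add: Vector_Spaces.linear_def module_hom_def module_hom_axioms_def)
  show z: "b 0 f = 0" for f
    using add[of 0 0 f] by (simp only: add_0_right add_cancel_right_right)
  show "b e 0 = 0"
    using z sym by metis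
qed

lemma vector_space_ssf_scale:
  assumes "vector_space scale"
  shows "vector_space (ssf_scale scale)"
proof -
  interpret vector_space scale by (fact assms)
  show ?thesis
    by unfold_locales
      (auto simp: ssf_scale_def algebra_simps)
qed

lemma ssf_mult_expand:
  assumes "vector_space scale"
  shows "ssf_mult scale b \<alpha> (e, x, y) (f, u, v) =
    (scale (\<alpha> * u + (1 - \<alpha>) * v) e + scale (\<alpha> * x + (1 - \<alpha>) * y) f,
     x * u - b e f * (\<alpha> * (\<alpha> - 2)), y * v - b e f * ((\<alpha> - 1) * (\<alpha> + 1)))"
proof -
  interpret vector_space scale by (fact assms)
  show ?thesis
    by (simp add: ssf_mult_def ssf_scale_def ssf_z_def ssf_z1_def ssf_z2_def ssf_emb_def)
qed

lemma ssf_algebra: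
  assumes "symmetric_bilinear_form scale b"
  shows "comm_nonassoc_algebra (ssf_scale scale) (ssf_mult scale b \<alpha>)"
proof -
  note b = symmetric_bilinear_formD[OF assms]
  interpret E: vector_space scale by (fact b(1))
  interpret vector_space "ssf_scale scale" by (rule vector_space_ssf_scale) (fact b(1))
  note expand = ssf_mult_expand[OF b(1)] ssf_scale_def
  show ?thesis
  proof unfold_locales
    fix u v w :: "'b \<times> 'a \<times> 'a" and c :: 'a
    obtain e x y where u: "u = (e, x, y)" by (cases u)
    obtain f x' y' where v: "v = (f, x', y')" by (cases v)
    obtain g x'' y'' where w: "w = (g, x'', y'')" by (cases w)
    show "ssf_mult scale b \<alpha> u v = ssf_mult scale b \<alpha> v u"
      by (simp add: u v expand b(2)[of f e] ac_simps)
    have "scale (\<alpha> * (x + x') + (1 - \<alpha>) * (y + y')) g =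
        scale (\<alpha> * x + (1 - \<alpha>) * y) g + scale (\<alpha> * x' + (1 - \<alpha>) * y') g"
      by (simp flip: E.scale_left_distrib) (simp add: algebra_simps)
    then show "ssf_mult scale b \<alpha> (u + v) w = ssf_mult scale b \<alpha> u w + ssf_mult scale b \<alpha> v w"
      by (simp add: u v w expand b(3) E.scale_right_distrib ac_simps) (simp add: algebra_simps)
    have "scale (\<alpha> * (c * x) + (1 - \<alpha>) * (c * y)) g = scale c (scale (\<alpha> * x + (1 - \<alpha>) * y) g)"
      by (simp add: algebra_simps)
    then show "ssf_mult scale b \<alpha> (ssf_scale scale c u) w = ssf_scale scale c (ssf_mult scale b \<alpha> u w)"
      by (simp add: u w expand b(4) E.scale_right_distrib ac_simps) (simp add: algebra_simps)
  qed
qed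

lemma ssf_mult_relations:
  assumes "symmetric_bilinear_form scale b"
  shows "ssf_mult scale b \<alpha> ssf_z1 ssf_z1 = ssf_z1"
    "ssf_mult scale b \<alpha> ssf_z2 ssf_z2 = ssf_z2"
    "ssf_mult scale b \<alpha> ssf_z1 ssf_z2 = 0"
    "ssf_mult scale b \<alpha> (ssf_emb e) ssf_z1 = ssf_scale scale \<alpha> (ssf_emb e)"
    "ssf_mult scale b \<alpha> (ssf_emb e) ssf_z2 = ssf_scale scale (1 - \<alpha>) (ssf_emb e)"
    "ssf_mult scale b \<alpha> (ssf_emb e) (ssf_emb f) = ssf_scale scale (- b e f) (ssf_z scale \<alpha>)"
proof -
  note b = symmetric_bilinear_formD[OF assms]
  interpret E: vector_space scale by (fact b(1))
  note defs = ssf_mult_def ssf_scale_def ssf_z_def ssf_z1_def ssf_z2_def ssf_emb_def zero_prod_def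
  show "ssf_mult scale b \<alpha> ssf_z1 ssf_z1 = ssf_z1"
    "ssf_mult scale b \<alpha> ssf_z2 ssf_z2 = ssf_z2"
    "ssf_mult scale b \<alpha> ssf_z1 ssf_z2 = 0"
    "ssf_mult scale b \<alpha> (ssf_emb e) ssf_z1 = ssf_scale scale \<alpha> (ssf_emb e)"
    "ssf_mult scale b \<alpha> (ssf_emb e) ssf_z2 = ssf_scale scale (1 - \<alpha>) (ssf_emb e)"
    "ssf_mult scale b \<alpha> (ssf_emb e) (ssf_emb f) = ssf_scale scale (- b e f) (ssf_z scale \<alpha>)"
    by (simp_all add: defs b(5,6))
qed

end

theory Submission
  imports Defs
begin

text \<open>
  The exchange of the coordinates of \<open>z\<^sub>1\<close> and \<open>z\<^sub>2\<close> is an isomorphism from \<open>S(b, \<alpha>)\<close> onto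
  \<open>S(b, 1 - \<alpha>)\<close> (\<open>ssf_swap_mult\<close>), because \<open>\<alpha> \<mapsto> 1 - \<alpha>\<close> exchanges the coefficients
  \<open>\<alpha> (\<alpha> - 2)\<close> and \<open>(\<alpha> - 1) (\<alpha> + 1)\<close> of \<open>z\<close>.  It exchanges \<open>z\<^sub>1\<close> with \<open>z\<^sub>2\<close> and turns family (a)
  for \<open>1 - \<alpha>\<close> into family (b) for \<open>\<alpha>\<close>.  Since isomorphisms preserve axes, only \<open>z\<^sub>1\<close> and family (a)
  have to be treated.

  For \<open>z\<^sub>1\<close> the eigenspaces are the three summands: \<open>\<bbbF> z\<^sub>1\<close> for \<open>1\<close>, \<open>\<bbbF> z\<^sub>2\<close> for \<open>0\<close>, and \<open>E\<close> for
  \<open>\<alpha>\<close>.  For \<open>a = (e + \<alpha> z\<^sub>1 + (\<alpha> + 1) z\<^sub>2) / 2\<close> with \<open>b e e = 1\<close>, multiplication by \<open>a\<close> acts as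
  \<open>1/2\<close> on the orthogonal complement \<open>e\<^sup>\<bottom>\<close> in \<open>E\<close>, and on the three-dimensional subalgebra
  \<open>B\<close> spanned by \<open>e\<close>, \<open>z\<^sub>1\<close>, \<open>z\<^sub>2\<close> it has the eigenvectors
  \<^item> \<open>a\<close> for the eigenvalue \<open>1\<close>,
  \<^item> \<open>w = e + (\<alpha> - 2) z\<^sub>1 + (\<alpha> - 1) z\<^sub>2\<close> for the eigenvalue \<open>0\<close>,
  \<^item> \<open>t = e + (2 - \<alpha>) z\<^sub>1 - (1 + \<alpha>) z\<^sub>2\<close> for the eigenvalue \<open>\<alpha>\<close>.

  The coordinate vectors of \<open>2 a\<close>, \<open>w\<close>, \<open>t\<close> have determinant \<open>8\<close>, so they span \<open>B\<close> as the
  characteristic is not \<open>2\<close>, and \<open>B + e\<^sup>\<bottom>\<close> is the whole algebra.  Eigenspaces for distinct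
  eigenvalues are independent, so these subspaces, whose sum is the algebra, are the complete
  eigenspaces (\<open>eigenspace_eqI\<close>); the eigenspace for \<open>1\<close> is then \<open>\<bbbF> a\<close>, which is primitivity.  The fusion law
  is then a short multiplication table: \<open>w w = - 2 w\<close>, \<open>w t = 2 (\<alpha> - 1) t\<close>,
  \<open>t t = 4 \<alpha> (2 - \<alpha>) a + 2 (\<alpha>\<^sup>2 - 1) w\<close>, while \<open>B\<close> maps \<open>e\<^sup>\<bottom>\<close> into itself and the
  product of two elements of \<open>e\<^sup>\<bottom>\<close> is a multiple of \<open>z \<in> B\<close>.
\<close>

section \<open>Eigenspaces in a commutative algebra\<close>

context comm_nonassoc_algebra
begin

lemma mult_add_right: "mult u (v + w) = mult u v + mult u w"
  using mult_add_left mult_commute by metis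

lemma mult_scale_right: "mult u (scale c v) = scale c (mult u v)"
  using mult_scale_left mult_commute by metis

lemma mult_zero_right: "mult u 0 = 0"
  using mult_scale_right[of u 0 0] by simp

lemma mult_diff_right: "mult u (v - w) = mult u v - mult u w"
  using mult_add_right[of u "v - w" w] by (simp add: algebra_simps)

lemma mult_sum_right: "mult u (\<Sum>i\<in>S. g i) = (\<Sum>i\<in>S. mult u (g i))"
  by (induction S rule: infinite_finite_induct) (simp_all add: mult_zero_right mult_add_right)

lemma eigenspace_zero: "0 \<in> eigenspace scale mult a \<nu>"
  by (simp add: eigenspace_def mult_zero_right)

lemma eigenspace_add:
  "u \<in> eigenspace scale mult a \<nu> \<Longrightarrow> v \<in> eigenspace scale mult a \<nu> \<Longrightarrow>
   u + v \<in> eigenspace scale mult a \<nu>"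
  by (simp add: eigenspace_def mult_add_right scale_right_distrib)

lemma eigenspace_diff:
  "u \<in> eigenspace scale mult a \<nu> \<Longrightarrow> v \<in> eigenspace scale mult a \<nu> \<Longrightarrow>
   u - v \<in> eigenspace scale mult a \<nu>"
  by (simp add: eigenspace_def mult_diff_right scale_right_diff_distrib)

lemma eigenspace_scale:
  "u \<in> eigenspace scale mult a \<nu> \<Longrightarrow> scale c u \<in> eigenspace scale mult a \<nu>"
  by (simp add: eigenspace_def mult_scale_right scale_left_commute)

lemma eigenspace_sum_finite:
  assumes "finite N"
  shows "x \<in> eigenspace_sum scale mult a N \<longleftrightarrow>
    (\<exists>g. (\<forall>\<nu>\<in>N. g \<nu> \<in> eigenspace scale mult a \<nu>) \<and> x = (\<Sum>\<nu>\<in>N. g \<nu>))"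
    (is "_ \<longleftrightarrow> ?R")
proof
  assume "x \<in> eigenspace_sum scale mult a N"
  then obtain S g where S: "S \<subseteq> N" "\<forall>\<nu>\<in>S. g \<nu> \<in> eigenspace scale mult a \<nu>" "x = (\<Sum>\<nu>\<in>S. g \<nu>)"
    by (auto simp: eigenspace_sum_def)
  let ?g = "\<lambda>\<nu>. if \<nu> \<in> S then g \<nu> else 0"
  have "x = (\<Sum>\<nu>\<in>N. ?g \<nu>)"
    using S assms by (simp add: sum.If_cases Int_absorb1)
  moreover have "\<forall>\<nu>\<in>N. ?g \<nu> \<in> eigenspace scale mult a \<nu>"
    using S(2) by (simp add: eigenspace_zero)
  ultimately show ?R by (intro exI[of _ ?g]) blast
next
  assume ?R
  then show "x \<in> eigenspace_sum scale mult a N"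
    using assms by (auto simp: eigenspace_sum_def)
qed

lemma eigenspace_sum_superset:
  assumes "finite N" "\<nu> \<in> N" "x \<in> eigenspace scale mult a \<nu>"
  shows "x \<in> eigenspace_sum scale mult a N"
proof -
  have "x = (\<Sum>\<mu>\<in>N. if \<mu> = \<nu> then x else 0)"
    using assms by simp
  then show ?thesis
    unfolding eigenspace_sum_finite[OF assms(1)]
    using assms(3) by (intro exI[of _ "\<lambda>\<mu>. if \<mu> = \<nu> then x else 0"]) (simp add: eigenspace_zero)
qed

lemma eigenspace_sum_add:
  assumes "finite N" "x \<in> eigenspace_sum scale mult a N" "y \<in> eigenspace_sum scale mult a N"
  shows "x + y \<in> eigenspace_sum scale mult a N"
proof -
  obtain g h where "\<forall>\<nu>\<in>N. g \<nu> \<in> eigenspace scale mult a \<nu>" "x = (\<Sum>\<nu>\<in>N. g \<nu>)"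
    "\<forall>\<nu>\<in>N. h \<nu> \<in> eigenspace scale mult a \<nu>" "y = (\<Sum>\<nu>\<in>N. h \<nu>)"
    using assms eigenspace_sum_finite by metis
  then show ?thesis
    unfolding eigenspace_sum_finite[OF assms(1)]
    by (intro exI[of _ "\<lambda>\<nu>. g \<nu> + h \<nu>"]) (simp add: sum.distrib eigenspace_add)
qed

lemma eigenvectors_independent:
  assumes "finite S" "\<forall>\<nu>\<in>S. g \<nu> \<in> eigenspace scale mult a \<nu>" "(\<Sum>\<nu>\<in>S. g \<nu>) = 0"
  shows "\<forall>\<nu>\<in>S. g \<nu> = 0"
  using assms
proof (induction S arbitrary: g rule: finite_induct)
  case empty
  then show ?case by simp
next
  case (insert \<kappa> S)
  \<comment> \<open>Multiplication by \<open>a\<close> minus \<open>\<kappa>\<close> kills the component for \<open>\<kappa>\<close> and rescales the others.\<close>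
  let ?h = "\<lambda>\<nu>. scale (\<nu> - \<kappa>) (g \<nu>)"
  have "0 = mult a (\<Sum>\<nu>\<in>insert \<kappa> S. g \<nu>) - scale \<kappa> (\<Sum>\<nu>\<in>insert \<kappa> S. g \<nu>)"
    using insert.prems(2) by (simp only: mult_zero_right scale_zero_right diff_zero)
  also have "\<dots> = (\<Sum>\<nu>\<in>insert \<kappa> S. mult a (g \<nu>) - scale \<kappa> (g \<nu>))"
    by (simp only: mult_sum_right scale_sum_right sum_subtractf)
  also have "\<dots> = (\<Sum>\<nu>\<in>insert \<kappa> S. ?h \<nu>)"
    using insert.prems(1) by (intro sum.cong) (auto simp: eigenspace_def scale_left_diff_distrib)
  also have "\<dots> = (\<Sum>\<nu>\<in>S. ?h \<nu>)"
    using insert.hyps by simp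
  finally have "(\<Sum>\<nu>\<in>S. ?h \<nu>) = 0" ..
  moreover have "\<forall>\<nu>\<in>S. ?h \<nu> \<in> eigenspace scale mult a \<nu>"
    using insert.prems(1) by (simp add: eigenspace_scale)
  ultimately have "\<forall>\<nu>\<in>S. ?h \<nu> = 0"
    by (rule insert.IH[rotated])
  then have *: "\<forall>\<nu>\<in>S. g \<nu> = 0"
    using insert.hyps(2) by auto
  then have "g \<kappa> = 0"
    using insert.prems(2) insert.hyps by simp
  with * show ?case by simp
qed

lemma eigenspaces_independent: "eigenspaces_independent scale mult a N"
  unfolding eigenspaces_independent_def using eigenvectors_independent by blast

text \<open>
  Sets of eigenvectors whose sum is the whole algebra are the full eigenspaces.
\<close>

lemma eigenspace_eqI:
  assumes F: "finite F" "\<kappa> \<in> F"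
    and V: "\<And>\<nu>. \<nu> \<in> F \<Longrightarrow> V \<nu> \<subseteq> eigenspace scale mult a \<nu>"
    and sum: "\<And>x. \<exists>h. (\<forall>\<nu>\<in>F. h \<nu> \<in> V \<nu>) \<and> x = (\<Sum>\<nu>\<in>F. h \<nu>)"
  shows "eigenspace scale mult a \<kappa> = V \<kappa>"
proof
  show "V \<kappa> \<subseteq> eigenspace scale mult a \<kappa>"
    using V F by simp
  show "eigenspace scale mult a \<kappa> \<subseteq> V \<kappa>"
  proof
    fix x assume x: "x \<in> eigenspace scale mult a \<kappa>"
    obtain h where h: "\<forall>\<nu>\<in>F. h \<nu> \<in> V \<nu>" "x = (\<Sum>\<nu>\<in>F. h \<nu>)"
      using sum by blast
    let ?g = "\<lambda>\<nu>. h \<nu> - (if \<nu> = \<kappa> then x else 0)"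
    have "\<forall>\<nu>\<in>F. ?g \<nu> \<in> eigenspace scale mult a \<nu>"
      using h(1) V x by (auto intro!: eigenspace_diff simp: eigenspace_zero)
    moreover have "(\<Sum>\<nu>\<in>F. ?g \<nu>) = 0"
      using F h(2) by (simp add: sum_subtractf)
    ultimately have "\<forall>\<nu>\<in>F. ?g \<nu> = 0"
      by (rule eigenvectors_independent[OF F(1)])
    then have "h \<kappa> = x"
      using F(2) by fastforce
    then show "x \<in> V \<kappa>"
      using h(1) F(2) by blast
  qed
qed

lemma mult_axis_eigenvector:
  assumes "v \<in> eigenspace scale mult a \<nu>"
  shows "mult (scale c a) v = scale (c * \<nu>) v"
  using assms by (simp add: eigenspace_def mult_scale_left)

section \<open>Criteria for primitive axes of Jordan and Monster type\<close>

text \<open>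
  The sets \<open>Z\<close> and \<open>T\<close> turn out to be the eigenspaces for \<open>0\<close> and \<open>\<alpha>\<close>, and in the second
  criterion \<open>H\<close> that for \<open>\<beta>\<close>.  The products with multiples of \<open>a\<close> need no hypothesis.
\<close>

lemma primitive_jordan_axisI:
  assumes dist: "distinct [1, 0, \<alpha>]"
    and a: "a \<noteq> 0" "mult a a = a"
    and Z: "Z \<subseteq> eigenspace scale mult a 0"
    and T: "T \<subseteq> eigenspace scale mult a \<alpha>"
    and dec: "\<And>x. \<exists>c. \<exists>z\<in>Z. \<exists>t\<in>T. x = scale c a + z + t"
    and ZZ: "\<And>z z'. z \<in> Z \<Longrightarrow> z' \<in> Z \<Longrightarrow> mult z z' \<in> Z"
    and ZT: "\<And>z t. z \<in> Z \<Longrightarrow> t \<in> T \<Longrightarrow> mult z t \<in> T"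
    and TT: "\<And>t t'. t \<in> T \<Longrightarrow> t' \<in> T \<Longrightarrow> \<exists>c. \<exists>z\<in>Z. mult t t' = scale c a + z"
  shows "jordan_axis scale mult \<alpha> a \<and> primitive scale mult a"
proof -
  let ?E = "eigenspace scale mult a" and ?S = "eigenspace_sum scale mult a"
  let ?F = "{1, 0, \<alpha>}" and ?star = "jordan_star \<alpha>"
  let ?V = "\<lambda>\<nu>. if \<nu> = 1 then range (\<lambda>c. scale c a) else if \<nu> = 0 then Z else T"
  have ne: "\<alpha> \<noteq> 0" "\<alpha> \<noteq> 1" "0 \<noteq> \<alpha>" "1 \<noteq> \<alpha>"
    using dist by auto
  have a1: "scale c a \<in> ?E 1" for c
    using a by (simp add: eigenspace_def mult_scale_right)
  have V: "?V \<nu> \<subseteq> ?E \<nu>" if "\<nu> \<in> ?F" for \<nu>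
    using that by (elim insertE emptyE) (use Z T ne in \<open>simp_all add: image_subset_iff a1\<close>)
  have sum: "\<exists>h. (\<forall>\<nu>\<in>?F. h \<nu> \<in> ?V \<nu>) \<and> x = (\<Sum>\<nu>\<in>?F. h \<nu>)" for x
  proof -
    obtain c z t where "z \<in> Z" "t \<in> T" "x = scale c a + z + t"
      using dec by blast
    then show ?thesis
      using ne by (intro exI[of _ "\<lambda>\<nu>. if \<nu> = 1 then scale c a else if \<nu> = 0 then z else t"])
        (auto simp: add.assoc)
  qed
  have E: "?E \<kappa> = ?V \<kappa>" if "\<kappa> \<in> ?F" for \<kappa>
  proof (rule eigenspace_eqI)
    show "finite ?F" by simp
  qed (fact that V sum)+
  have E1: "?E 1 = range (\<lambda>c. scale c a)"
    using E[of 1] by simp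
  have E0: "?E 0 = Z"
    using E[of 0] by simp
  have E\<alpha>: "?E \<alpha> = T"
    using E[of \<alpha>] ne by simp
  have S: "x \<in> ?S N" if "finite N" "\<nu> \<in> N" "x \<in> ?E \<nu>" for x N \<nu>
    using that by (rule eigenspace_sum_superset)
  have UNIV: "?S ?F = UNIV"
  proof -
    have "x \<in> ?S ?F" for x
      using sum[of x] V eigenspace_sum_finite[of ?F x a] by blast
    then show ?thesis by blast
  qed
  have star: "?star 1 1 = {1}" "?star 1 0 = {}" "?star 0 0 = {0}" "?star 1 \<alpha> = {\<alpha>}"
    "?star 0 \<alpha> = {\<alpha>}" "?star \<alpha> \<alpha> = {1, 0}" "?star 0 1 = {}" "?star \<alpha> 1 = {\<alpha>}" "?star \<alpha> 0 = {\<alpha>}"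
    using ne by (simp_all add: jordan_star_def doubleton_eq_iff)
  have zero: "0 \<in> ?S {}"
    by (simp add: eigenspace_sum_def)
  have m11: "mult u v \<in> ?S (?star 1 1)" if "u \<in> ?E 1" "v \<in> ?E 1" for u v
    using that unfolding star by (intro S[of _ 1]) (auto simp: E1 mult_scale_left mult_scale_right a)
  have m10: "mult u v \<in> ?S (?star 1 0)" if "u \<in> ?E 1" "v \<in> ?E 0" for u v
    using that mult_axis_eigenvector[OF that(2)] zero unfolding star by (auto simp: E1)
  have m1\<alpha>: "mult u v \<in> ?S (?star 1 \<alpha>)" if "u \<in> ?E 1" "v \<in> ?E \<alpha>" for u v
    using that mult_axis_eigenvector[OF that(2)] unfolding star
    by (intro S[of _ \<alpha>]) (auto simp: E1 eigenspace_scale)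
  have m00: "mult u v \<in> ?S (?star 0 0)" if "u \<in> ?E 0" "v \<in> ?E 0" for u v
    using that ZZ unfolding star by (intro S[of _ 0]) (auto simp: E0)
  have m0\<alpha>: "mult u v \<in> ?S (?star 0 \<alpha>)" if "u \<in> ?E 0" "v \<in> ?E \<alpha>" for u v
    using that ZT unfolding star by (intro S[of _ \<alpha>]) (auto simp: E0 E\<alpha>)
  have m\<alpha>\<alpha>: "mult u v \<in> ?S (?star \<alpha> \<alpha>)" if uv: "u \<in> ?E \<alpha>" "v \<in> ?E \<alpha>" for u v
  proof -
    obtain c z where "z \<in> Z" "mult u v = scale c a + z"
      using TT[of u v] uv unfolding E\<alpha> by blast
    then show ?thesis
      unfolding star using a1
      by (simp, intro eigenspace_sum_add S[of _ 1 "scale c a"] S[of _ 0 z]) (simp_all add: E0)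
  qed
  have m01: "mult u v \<in> ?S (?star 0 1)" if "u \<in> ?E 0" "v \<in> ?E 1" for u v
    using m10[OF that(2,1)] by (simp add: star mult_commute[of v])
  have m\<alpha>1: "mult u v \<in> ?S (?star \<alpha> 1)" if "u \<in> ?E \<alpha>" "v \<in> ?E 1" for u v
    using m1\<alpha>[OF that(2,1)] by (simp add: star mult_commute[of v])
  have m\<alpha>0: "mult u v \<in> ?S (?star \<alpha> 0)" if "u \<in> ?E \<alpha>" "v \<in> ?E 0" for u v
    using m0\<alpha>[OF that(2,1)] by (simp add: star mult_commute[of v])
  have "\<forall>\<kappa>\<in>?F. \<forall>\<mu>\<in>?F. \<forall>u\<in>?E \<kappa>. \<forall>v\<in>?E \<mu>. mult u v \<in> ?S (?star \<kappa> \<mu>)"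
    unfolding ball_simps(5,7)
    by (intro conjI ballI TrueI)
      ((rule m11 m10 m1\<alpha> m01 m00 m0\<alpha> m\<alpha>1 m\<alpha>0 m\<alpha>\<alpha>); assumption)+
  moreover have "fusion_law ?F ?star"
    by (simp add: fusion_law_def star)
  ultimately show ?thesis
    using dist a UNIV eigenspaces_independent E1
    by (simp add: jordan_axis_def fusion_axis_def primitive_def)
qed

lemma primitive_monster_axisI:
  assumes dist: "distinct [1, 0, \<alpha>, \<beta>]"
    and a: "a \<noteq> 0" "mult a a = a"
    and Z: "Z \<subseteq> eigenspace scale mult a 0"
    and T: "T \<subseteq> eigenspace scale mult a \<alpha>"
    and H: "H \<subseteq> eigenspace scale mult a \<beta>"
    and dec: "\<And>x. \<exists>c. \<exists>z\<in>Z. \<exists>t\<in>T. \<exists>h\<in>H. x = scale c a + z + t + h"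
    and ZZ: "\<And>z z'. z \<in> Z \<Longrightarrow> z' \<in> Z \<Longrightarrow> mult z z' \<in> Z"
    and ZT: "\<And>z t. z \<in> Z \<Longrightarrow> t \<in> T \<Longrightarrow> mult z t \<in> T"
    and TT: "\<And>t t'. t \<in> T \<Longrightarrow> t' \<in> T \<Longrightarrow> \<exists>c. \<exists>z\<in>Z. mult t t' = scale c a + z"
    and ZH: "\<And>z h. z \<in> Z \<Longrightarrow> h \<in> H \<Longrightarrow> mult z h \<in> H"
    and TH: "\<And>t h. t \<in> T \<Longrightarrow> h \<in> H \<Longrightarrow> mult t h \<in> H"
    and HH: "\<And>h h'. h \<in> H \<Longrightarrow> h' \<in> H \<Longrightarrow> \<exists>c. \<exists>z\<in>Z. \<exists>t\<in>T. mult h h' = scale c a + z + t"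
  shows "monster_axis scale mult \<alpha> \<beta> a \<and> primitive scale mult a"
proof -
  let ?E = "eigenspace scale mult a" and ?S = "eigenspace_sum scale mult a"
  let ?F = "{1, 0, \<alpha>, \<beta>}" and ?star = "monster_star \<alpha> \<beta>"
  let ?V = "\<lambda>\<nu>. if \<nu> = 1 then range (\<lambda>c. scale c a) else if \<nu> = 0 then Z
    else if \<nu> = \<alpha> then T else H"
  have ne: "\<alpha> \<noteq> 0" "\<alpha> \<noteq> 1" "0 \<noteq> \<alpha>" "1 \<noteq> \<alpha>" "\<beta> \<noteq> 0" "\<beta> \<noteq> 1" "0 \<noteq> \<beta>" "1 \<noteq> \<beta>" "\<beta> \<noteq> \<alpha>" "\<alpha> \<noteq> \<beta>"
    using dist by auto
  have a1: "scale c a \<in> ?E 1" for c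
    using a by (simp add: eigenspace_def mult_scale_right)
  have V: "?V \<nu> \<subseteq> ?E \<nu>" if "\<nu> \<in> ?F" for \<nu>
    using that by (elim insertE emptyE) (use Z T H ne in \<open>simp_all add: image_subset_iff a1\<close>)
  have sum: "\<exists>h. (\<forall>\<nu>\<in>?F. h \<nu> \<in> ?V \<nu>) \<and> x = (\<Sum>\<nu>\<in>?F. h \<nu>)" for x
  proof -
    obtain c z t h where "z \<in> Z" "t \<in> T" "h \<in> H" "x = scale c a + z + t + h"
      using dec by blast
    then show ?thesis
      using ne by (intro exI[of _ "\<lambda>\<nu>. if \<nu> = 1 then scale c a else if \<nu> = 0 then z
          else if \<nu> = \<alpha> then t else h"]) (auto simp: add.assoc)
  qed
  have E: "?E \<kappa> = ?V \<kappa>" if "\<kappa> \<in> ?F" for \<kappa>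
  proof (rule eigenspace_eqI)
    show "finite ?F" by simp
  qed (fact that V sum)+
  have E1: "?E 1 = range (\<lambda>c. scale c a)"
    using E[of 1] by simp
  have E0: "?E 0 = Z"
    using E[of 0] by simp
  have E\<alpha>: "?E \<alpha> = T"
    using E[of \<alpha>] ne by simp
  have E\<beta>: "?E \<beta> = H"
    using E[of \<beta>] ne by simp
  have S: "x \<in> ?S N" if "finite N" "\<nu> \<in> N" "x \<in> ?E \<nu>" for x N \<nu>
    using that by (rule eigenspace_sum_superset)
  have UNIV: "?S ?F = UNIV"
  proof -
    have "x \<in> ?S ?F" for x
      using sum[of x] V eigenspace_sum_finite[of ?F x a] by blast
    then show ?thesis by blast
  qed
  note table = monster_star_table(1-10)[OF dist]
  note sym = monster_star_table(11)[OF dist]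
  have zero: "0 \<in> ?S {}"
    by (simp add: eigenspace_sum_def)
  have m1: "mult u v \<in> ?E \<nu>" if "u \<in> ?E 1" "v \<in> ?E \<nu>" for u v \<nu>
    using that mult_axis_eigenvector[OF that(2)] by (auto simp: E1 eigenspace_scale)
  have m11: "mult u v \<in> ?S (?star 1 1)" if "u \<in> ?E 1" "v \<in> ?E 1" for u v
    using that m1 unfolding table by (intro S[of _ 1]) auto
  have m10: "mult u v \<in> ?S (?star 1 0)" if "u \<in> ?E 1" "v \<in> ?E 0" for u v
    using that mult_axis_eigenvector[OF that(2)] zero unfolding table by (auto simp: E1)
  have m1\<alpha>: "mult u v \<in> ?S (?star 1 \<alpha>)" if "u \<in> ?E 1" "v \<in> ?E \<alpha>" for u v
    using that m1 unfolding table by (intro S[of _ \<alpha>]) auto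
  have m1\<beta>: "mult u v \<in> ?S (?star 1 \<beta>)" if "u \<in> ?E 1" "v \<in> ?E \<beta>" for u v
    using that m1 unfolding table by (intro S[of _ \<beta>]) auto
  have m00: "mult u v \<in> ?S (?star 0 0)" if "u \<in> ?E 0" "v \<in> ?E 0" for u v
    using that ZZ unfolding table by (intro S[of _ 0]) (auto simp: E0)
  have m0\<alpha>: "mult u v \<in> ?S (?star 0 \<alpha>)" if "u \<in> ?E 0" "v \<in> ?E \<alpha>" for u v
    using that ZT unfolding table by (intro S[of _ \<alpha>]) (auto simp: E0 E\<alpha>)
  have m0\<beta>: "mult u v \<in> ?S (?star 0 \<beta>)" if "u \<in> ?E 0" "v \<in> ?E \<beta>" for u v
    using that ZH unfolding table by (intro S[of _ \<beta>]) (auto simp: E0 E\<beta>)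
  have m\<alpha>\<alpha>: "mult u v \<in> ?S (?star \<alpha> \<alpha>)" if uv: "u \<in> ?E \<alpha>" "v \<in> ?E \<alpha>" for u v
  proof -
    obtain c z where "z \<in> Z" "mult u v = scale c a + z"
      using TT[of u v] uv unfolding E\<alpha> by blast
    then show ?thesis
      unfolding table using a1
      by (simp, intro eigenspace_sum_add S[of _ 1 "scale c a"] S[of _ 0 z]) (simp_all add: E0)
  qed
  have m\<alpha>\<beta>: "mult u v \<in> ?S (?star \<alpha> \<beta>)" if "u \<in> ?E \<alpha>" "v \<in> ?E \<beta>" for u v
    using that TH unfolding table by (intro S[of _ \<beta>]) (auto simp: E\<alpha> E\<beta>)
  have m\<beta>\<beta>: "mult u v \<in> ?S (?star \<beta> \<beta>)" if uv: "u \<in> ?E \<beta>" "v \<in> ?E \<beta>" for u v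
  proof -
    obtain c z t where "z \<in> Z" "t \<in> T" "mult u v = scale c a + z + t"
      using HH[of u v] uv unfolding E\<beta> by blast
    then show ?thesis
      unfolding table using a1
      by (simp, intro eigenspace_sum_add S[of _ 1 "scale c a"] S[of _ 0 z] S[of _ \<alpha> t])
        (simp_all add: E0 E\<alpha>)
  qed
  have comm: "mult u v \<in> ?S (?star \<kappa> \<mu>)"
    if "\<And>u v. u \<in> ?E \<mu> \<Longrightarrow> v \<in> ?E \<kappa> \<Longrightarrow> mult u v \<in> ?S (?star \<mu> \<kappa>)" "u \<in> ?E \<kappa>" "v \<in> ?E \<mu>" for u v \<kappa> \<mu>
    using that(1)[OF that(3,2)] by (simp add: sym[of \<mu>] mult_commute[of v])
  have "\<forall>\<kappa>\<in>?F. \<forall>\<mu>\<in>?F. \<forall>u\<in>?E \<kappa>. \<forall>v\<in>?E \<mu>. mult u v \<in> ?S (?star \<kappa> \<mu>)"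
    unfolding ball_simps(5,7)
    by (intro conjI ballI TrueI)
      ((rule m11 m10 m1\<alpha> m1\<beta> m00 m0\<alpha> m0\<beta> m\<alpha>\<alpha> m\<alpha>\<beta> m\<beta>\<beta>
        comm[OF m10] comm[OF m1\<alpha>] comm[OF m1\<beta>] comm[OF m0\<alpha>] comm[OF m0\<beta>] comm[OF m\<alpha>\<beta>]); assumption)+
  moreover have "?star \<kappa> \<mu> \<subseteq> ?F" for \<kappa> \<mu>
    by (simp add: monster_star_def jordan_star_def)
  then have "fusion_law ?F ?star"
    unfolding fusion_law_def by (intro conjI ballI insertI1 sym)
  ultimately show ?thesis
    using dist a UNIV eigenspaces_independent E1
    by (simp add: monster_axis_def fusion_axis_def primitive_def)
qed

end

section \<open>Transport of axes along isomorphisms\<close>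

lemma eigenspace_iso:
  assumes bij: "bij \<phi>"
    and scale: "\<And>c u. \<phi> (s c u) = s' c (\<phi> u)"
    and mult: "\<And>u v. \<phi> (m u v) = m' (\<phi> u) (\<phi> v)"
  shows "\<phi> u \<in> eigenspace s' m' (\<phi> a) \<nu> \<longleftrightarrow> u \<in> eigenspace s m a \<nu>"
  using bij_is_inj[OF bij] by (simp add: eigenspace_def inj_eq flip: scale mult)

lemma eigenspace_sum_iso:
  assumes add: "\<And>u v. \<phi> (u + v) = \<phi> u + \<phi> v"
    and scale: "\<And>c u. \<phi> (s c u) = s' c (\<phi> u)"
    and mult: "\<And>u v. \<phi> (m u v) = m' (\<phi> u) (\<phi> v)"
    and x: "x \<in> eigenspace_sum s m a N"
  shows "\<phi> x \<in> eigenspace_sum s' m' (\<phi> a) N"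
proof -
  obtain S g where S: "finite S" "S \<subseteq> N" "\<forall>\<nu>\<in>S. g \<nu> \<in> eigenspace s m a \<nu>" "x = (\<Sum>\<nu>\<in>S. g \<nu>)"
    using x by (auto simp: eigenspace_sum_def)
  have zero: "\<phi> 0 = 0"
    using add[of 0 0] by simp
  have "\<phi> x = (\<Sum>\<nu>\<in>S. \<phi> (g \<nu>))"
    unfolding S(4) using sum_comp_morphism[of \<phi> g S, OF zero add] by (simp add: comp_def)
  moreover have "\<forall>\<nu>\<in>S. \<phi> (g \<nu>) \<in> eigenspace s' m' (\<phi> a) \<nu>"
    using S(3) by (simp add: eigenspace_def flip: scale mult)
  ultimately show ?thesis
    using S(1,2) unfolding eigenspace_sum_def
    by (intro CollectI exI[of _ S] exI[of _ "\<lambda>\<nu>. \<phi> (g \<nu>)"]) auto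
qed

lemma fusion_axis_iso:
  assumes alg: "comm_nonassoc_algebra s' m'"
    and bij: "bij \<phi>"
    and add: "\<And>u v. \<phi> (u + v) = \<phi> u + \<phi> v"
    and scale: "\<And>c u. \<phi> (s c u) = s' c (\<phi> u)"
    and mult: "\<And>u v. \<phi> (m u v) = m' (\<phi> u) (\<phi> v)"
    and axis: "fusion_axis s m F star a"
  shows "fusion_axis s' m' F star (\<phi> a)"
proof -
  note E = eigenspace_iso[of \<phi> s s' m m', OF bij scale mult]
  note S = eigenspace_sum_iso[of \<phi> s s' m m', OF add scale mult]
  have surj: "\<exists>v. u = \<phi> v" for u
    using bij_is_surj[OF bij] by blast
  have "\<phi> 0 = 0"
    using add[of 0 0] by simp
  then have "\<phi> a \<noteq> 0"
    using axis bij_is_inj[OF bij] unfolding fusion_axis_def by (metis injD)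
  moreover have "m' (\<phi> a) (\<phi> a) = \<phi> a"
    using axis by (simp add: fusion_axis_def flip: mult)
  moreover have "x \<in> eigenspace_sum s' m' (\<phi> a) F" for x
    using surj[of x] S[of _ a F] axis unfolding fusion_axis_def by blast
  then have "eigenspace_sum s' m' (\<phi> a) F = UNIV"
    by blast
  moreover have "eigenspaces_independent s' m' (\<phi> a) F"
    by (rule comm_nonassoc_algebra.eigenspaces_independent[OF alg])
  moreover have "m' u v \<in> eigenspace_sum s' m' (\<phi> a) (star \<kappa> \<mu>)"
    if "\<kappa> \<in> F" "\<mu> \<in> F" "u \<in> eigenspace s' m' (\<phi> a) \<kappa>" "v \<in> eigenspace s' m' (\<phi> a) \<mu>" for \<kappa> \<mu> u v
  proof -
    obtain x y where xy: "u = \<phi> x" "v = \<phi> y"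
      using surj by blast
    then have "m x y \<in> eigenspace_sum s m a (star \<kappa> \<mu>)"
      using that axis by (simp add: fusion_axis_def E)
    then show ?thesis
      using S by (simp add: xy flip: mult)
  qed
  ultimately show ?thesis
    using axis by (simp add: fusion_axis_def)
qed

lemma primitive_iso:
  assumes bij: "bij \<phi>"
    and scale: "\<And>c u. \<phi> (s c u) = s' c (\<phi> u)"
    and mult: "\<And>u v. \<phi> (m u v) = m' (\<phi> u) (\<phi> v)"
    and prim: "primitive s m a"
  shows "primitive s' m' (\<phi> a)"
proof -
  note E = eigenspace_iso[of \<phi> s s' m m', OF bij scale mult]
  have "eigenspace s' m' (\<phi> a) 1 = \<phi> ` eigenspace s m a 1"
  proof (intro set_eqI iffI)
    fix x assume x: "x \<in> eigenspace s' m' (\<phi> a) 1"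
    obtain y where "x = \<phi> y"
      using bij_is_surj[OF bij] by (rule surjE)
    then show "x \<in> \<phi> ` eigenspace s m a 1"
      using x E by simp
  next
    fix x assume "x \<in> \<phi> ` eigenspace s m a 1"
    then show "x \<in> eigenspace s' m' (\<phi> a) 1"
      using E by auto
  qed
  also have "\<dots> = range (\<lambda>c. s' c (\<phi> a))"
    using prim by (simp add: primitive_def image_image scale)
  finally show ?thesis
    by (simp add: primitive_def)
qed

section \<open>Axes in the split spin factor\<close>

text \<open>
  The exchange of the two idempotents \<open>z\<^sub>1\<close> and \<open>z\<^sub>2\<close>.
\<close>

definition ssf_swap :: "'e \<times> 'f \<times> 'f \<Rightarrow> 'e \<times> 'f \<times> 'f" where
  "ssf_swap = (\<lambda>(e, x, y). (e, y, x))"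

lemma bij_ssf_swap: "bij ssf_swap"
  by (rule involuntory_imp_bij) (simp add: ssf_swap_def split: prod.splits)

lemma ssf_swap_add: "ssf_swap (u + v) = ssf_swap u + ssf_swap v"
  by (cases u; cases v) (simp add: ssf_swap_def)

lemma ssf_swap_scale: "ssf_swap (ssf_scale scale c u) = ssf_scale scale c (ssf_swap u)"
  by (cases u) (simp add: ssf_swap_def ssf_scale_def)

lemma ssf_swap_mult:
  assumes "vector_space scale"
  shows "ssf_swap (ssf_mult scale b (1 - \<alpha>) u v) = ssf_mult scale b \<alpha> (ssf_swap u) (ssf_swap v)"
  by (cases u; cases v)
    (simp add: ssf_swap_def ssf_mult_expand[OF assms], simp add: algebra_simps)

lemma ssf_z1_primitive_jordan_axis:
  assumes b: "symmetric_bilinear_form scale b" and "\<alpha> \<noteq> 0" "\<alpha> \<noteq> 1"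
  shows "jordan_axis (ssf_scale scale) (ssf_mult scale b \<alpha>) \<alpha> ssf_z1 \<and>
    primitive (ssf_scale scale) (ssf_mult scale b \<alpha>) ssf_z1"
proof -
  note bD = symmetric_bilinear_formD[OF b]
  interpret E: vector_space scale by (fact bD(1))
  interpret comm_nonassoc_algebra "ssf_scale scale" "ssf_mult scale b \<alpha>"
    by (rule ssf_algebra[OF b])
  note defs = ssf_mult_expand[OF bD(1)] ssf_scale_def ssf_z1_def bD(5,6) zero_prod_def
  show ?thesis
  proof (rule primitive_jordan_axisI[where Z = "range (\<lambda>v. (0, 0, v))" and T = "range (\<lambda>f. (f, 0, 0))"])
    show "distinct [1, 0, \<alpha>]"
      using assms by auto
  qed (auto simp: defs eigenspace_def image_iff)
qed

text \<open>
  Multiplication in the subalgebra spanned by \<open>e\<close>, \<open>z\<^sub>1\<close>, \<open>z\<^sub>2\<close>.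
\<close>

lemma ssf_mult_line:
  assumes b: "symmetric_bilinear_form scale b" and e: "b e e = 1"
  shows "ssf_mult scale b \<alpha> (scale c e, x, y) (scale d e, u, v) =
    (scale ((\<alpha> * u + (1 - \<alpha>) * v) * c + (\<alpha> * x + (1 - \<alpha>) * y) * d) e,
     x * u - c * d * (\<alpha> * (\<alpha> - 2)), y * v - c * d * ((\<alpha> - 1) * (\<alpha> + 1)))"
proof -
  note bD = symmetric_bilinear_formD[OF b]
  interpret E: vector_space scale by (fact bD(1))
  have "b (scale c e) (scale d e) = c * d"
    using bD(4)[of c e "scale d e"] bD(2)[of e "scale d e"] bD(4)[of d e e] e by simp
  then show ?thesis
    by (simp add: ssf_mult_expand[OF bD(1)] E.scale_left_distrib)
qed

text \<open>
  The products of elements of the subalgebra spanned by \<open>e\<close>, \<open>z\<^sub>1\<close>, \<open>z\<^sub>2\<close> with elements of the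
  orthogonal complement of \<open>e\<close>.
\<close>

lemma ssf_mult_line_orthogonal:
  assumes b: "symmetric_bilinear_form scale b" and h: "b e h = 0"
  shows "ssf_mult scale b \<alpha> (scale c e, x, y) (h, 0, 0) = (scale (\<alpha> * x + (1 - \<alpha>) * y) h, 0, 0)"
proof -
  note bD = symmetric_bilinear_formD[OF b]
  interpret E: vector_space scale by (fact bD(1))
  show ?thesis
    using h by (simp add: ssf_mult_expand[OF bD(1)] bD(4))
qed

lemma ssf_family_a_primitive_monster_axis:
  fixes scale :: "'f::field \<Rightarrow> 'e::ab_group_add \<Rightarrow> 'e"
  assumes b: "symmetric_bilinear_form scale b"
    and \<alpha>: "\<alpha> \<noteq> 0" "\<alpha> \<noteq> 1" "2 * \<alpha> \<noteq> 1" and two: "(2::'f) \<noteq> 0" and e: "b e e = 1"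
  defines "a \<equiv> ssf_scale scale (1 / 2)
    (ssf_emb e + ssf_scale scale \<alpha> ssf_z1 + ssf_scale scale (\<alpha> + 1) ssf_z2)"
  shows "monster_axis (ssf_scale scale) (ssf_mult scale b \<alpha>) \<alpha> (1 / 2) a \<and>
    primitive (ssf_scale scale) (ssf_mult scale b \<alpha>) a"
proof -
  note bD = symmetric_bilinear_formD[OF b]
  interpret E: vector_space scale by (fact bD(1))
  interpret comm_nonassoc_algebra "ssf_scale scale" "ssf_mult scale b \<alpha>"
    by (rule ssf_algebra[OF b])
  have a: "a = (scale (1 / 2) e, \<alpha> / 2, (\<alpha> + 1) / 2)"
    by (simp add: a_def ssf_scale_def ssf_emb_def ssf_z1_def ssf_z2_def)
  have four: "(4::'f) \<noteq> 0"
    using two mult_eq_0_iff[of "2::'f" 2] by simp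
  then have sixteen: "(16::'f) \<noteq> 0"
    using mult_eq_0_iff[of "4::'f" 4] by simp
  note line = ssf_mult_line[OF b e]
  note orth = ssf_mult_line_orthogonal[OF b]
  \<comment> \<open>The lines spanned by \<open>w\<close> and \<open>t\<close>, and the orthogonal complement of \<open>e\<close> in \<open>E\<close>.\<close>
  define Z where "Z = range (\<lambda>c. (scale c e, c * (\<alpha> - 2), c * (\<alpha> - 1)))"
  define T where "T = range (\<lambda>c. (scale c e, c * (2 - \<alpha>), - c * (1 + \<alpha>)))"
  define H where "H = (\<lambda>h. (h, 0::'f, 0::'f)) ` {h. b e h = 0}"
  have ZI: "(scale c e, x, y) \<in> Z" if "x = c * (\<alpha> - 2)" "y = c * (\<alpha> - 1)" for c x y
    unfolding that Z_def by (rule rangeI)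
  have TI: "(scale c e, x, y) \<in> T" if "x = c * (2 - \<alpha>)" "y = - c * (1 + \<alpha>)" for c x y
    unfolding that T_def by (rule rangeI)
  have b_right: "b f (scale c h) = c * b f h" for c f h
    using bD(2)[of f] bD(4)[of c h f] by simp
  have orthH: "ssf_mult scale b \<alpha> (scale c e, x, y) h \<in> H" if "h \<in> H" for c x y h
    using that by (auto simp: H_def orth b_right)
  \<comment> \<open>The coefficients \<open>p\<close>, \<open>q\<close>, \<open>r\<close> of \<open>2 a\<close>, \<open>w\<close>, \<open>t\<close> solve the linear system with determinant \<open>8\<close>.\<close>
  have span: "\<exists>p. \<exists>z\<in>Z. \<exists>t\<in>T. (scale c e, u, v) = ssf_scale scale p a + z + t" for c u v
  proof -
    define r where "r = (u - v + c) / 4"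
    define q where "q = (1 - \<alpha>) * r - (u - \<alpha> * c) / 2"
    define p where "p = c - q - r"
    have q: "2 * q = 2 * (1 - \<alpha>) * r - (u - \<alpha> * c)"
    proof -
      have half: "2 * (x / 2) = x" for x :: 'f
        using two by simp
      show ?thesis
        by (simp only: q_def right_diff_distrib[of 2 "(1 - \<alpha>) * r"] half mult.assoc)
    qed
    have r: "4 * r = u - v + c"
      using four by (simp add: r_def)
    have "c = p + q + r"
      by (simp add: p_def)
    moreover have "u = p * \<alpha> + q * (\<alpha> - 2) + r * (2 - \<alpha>)"
      using q p_def by algebra
    moreover have "v = p * (\<alpha> + 1) + q * (\<alpha> - 1) + - r * (1 + \<alpha>)"
      using q r p_def by algebra
    ultimately have "(scale c e, u, v) = ssf_scale scale (2 * p) a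
        + (scale q e, q * (\<alpha> - 2), q * (\<alpha> - 1)) + (scale r e, r * (2 - \<alpha>), - r * (1 + \<alpha>))"
      using two by (simp add: a ssf_scale_def E.scale_left_distrib)
    then show ?thesis
      using ZI[OF refl refl, of q] TI[OF refl refl, of r] by blast
  qed
  show ?thesis
  proof (rule primitive_monster_axisI)
    have "(2::'f) \<noteq> 1"
      by (metis one_add_one add_cancel_right_right zero_neq_one)
    then show "distinct [1, 0, \<alpha>, 1 / 2]"
      using \<alpha> two by (auto simp: field_simps)
    have "\<alpha> / 2 \<noteq> 0"
      using \<alpha> two by simp
    then show "a \<noteq> 0"
      by (simp add: a zero_prod_def)
    show "ssf_mult scale b \<alpha> a a = a"
      using two four sixteen by (simp add: a line field_simps)
    show "Z \<subseteq> eigenspace (ssf_scale scale) (ssf_mult scale b \<alpha>) a 0"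
    proof -
      have "(\<alpha> * (c * (\<alpha> - 2)) + (1 - \<alpha>) * (c * (\<alpha> - 1))) * (1 / 2)
          + (\<alpha> * (\<alpha> / 2) + (1 - \<alpha>) * ((\<alpha> + 1) / 2)) * c = 0" for c
        using two four by (simp add: field_simps)
      then show ?thesis
        by (auto simp: Z_def eigenspace_def a line ssf_scale_def)
    qed
    show "T \<subseteq> eigenspace (ssf_scale scale) (ssf_mult scale b \<alpha>) a \<alpha>"
    proof -
      have "(\<alpha> * (c * (2 - \<alpha>)) + (1 - \<alpha>) * (- c * (1 + \<alpha>))) * (1 / 2)
          + (\<alpha> * (\<alpha> / 2) + (1 - \<alpha>) * ((\<alpha> + 1) / 2)) * c = \<alpha> * c"
        "\<alpha> / 2 * (c * (2 - \<alpha>)) - 1 / 2 * c * (\<alpha> * (\<alpha> - 2)) = \<alpha> * (c * (2 - \<alpha>))"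
        "(\<alpha> + 1) / 2 * (- c * (1 + \<alpha>)) - 1 / 2 * c * ((\<alpha> - 1) * (\<alpha> + 1)) = \<alpha> * (- c * (1 + \<alpha>))" for c
        using two four by (simp_all add: field_simps)
      then show ?thesis
        unfolding T_def eigenspace_def a by (auto simp only: line ssf_scale_def prod.case E.scale_scale)
    qed
    show "H \<subseteq> eigenspace (ssf_scale scale) (ssf_mult scale b \<alpha>) a (1 / 2)"
    proof -
      have "\<alpha> * (\<alpha> / 2) + (1 - \<alpha>) * ((\<alpha> + 1) / 2) = 1 / 2"
        using two four by (simp add: field_simps)
      then show ?thesis
        by (auto simp: H_def eigenspace_def a orth ssf_scale_def)
    qed
    show "\<exists>c. \<exists>z\<in>Z. \<exists>t\<in>T. \<exists>h\<in>H. x = ssf_scale scale c a + z + t + h" for x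
    proof -
      obtain f u v where x: "x = (f, u, v)"
        by (cases x)
      \<comment> \<open>The component of \<open>f\<close> orthogonal to \<open>e\<close>.\<close>
      define h where "h = f - scale (b e f) e"
      have "b e f = b e (scale (b e f) e) + b e h"
        using bD(2)[of e] bD(3)[of "scale (b e f) e" h e] by (simp add: h_def)
      then have h: "(h, 0, 0) \<in> H"
        using e by (simp add: H_def b_right)
      obtain p z t where "z \<in> Z" "t \<in> T"
        and "(scale (b e f) e, u, v) = ssf_scale scale p a + z + t"
        using span by blast
      moreover from this have "x = ssf_scale scale p a + z + t + (h, 0, 0)"
        by (simp add: x h_def flip: \<open>_ = ssf_scale scale p a + z + t\<close>)
      ultimately show ?thesis
        using h by blast
    qed
    show "ssf_mult scale b \<alpha> z z' \<in> Z" if zz: "z \<in> Z" "z' \<in> Z" for z z'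
    proof -
      obtain c d where z: "z = (scale c e, c * (\<alpha> - 2), c * (\<alpha> - 1))"
        "z' = (scale d e, d * (\<alpha> - 2), d * (\<alpha> - 1))"
        using zz by (auto simp: Z_def)
      show ?thesis
        unfolding z line by (rule ZI; algebra)
    qed
    show "ssf_mult scale b \<alpha> z t \<in> T" if zt: "z \<in> Z" "t \<in> T" for z t
    proof -
      obtain c d where zt': "z = (scale c e, c * (\<alpha> - 2), c * (\<alpha> - 1))"
        "t = (scale d e, d * (2 - \<alpha>), - d * (1 + \<alpha>))"
        using zt by (auto simp: Z_def T_def)
      show ?thesis
        unfolding zt' line by (rule TI; algebra)
    qed
    show "\<exists>p. \<exists>z\<in>Z. ssf_mult scale b \<alpha> t t' = ssf_scale scale p a + z" if tt: "t \<in> T" "t' \<in> T" for t t'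
    proof -
      obtain c d where t: "t = (scale c e, c * (2 - \<alpha>), - c * (1 + \<alpha>))"
        "t' = (scale d e, d * (2 - \<alpha>), - d * (1 + \<alpha>))"
        using tt by (auto simp: T_def)
      \<comment> \<open>The product is a combination of \<open>2 a\<close> and \<open>w\<close> with these coefficients.\<close>
      define p where "p = c * d * (2 * \<alpha> * (2 - \<alpha>))"
      define q where "q = c * d * (2 * (\<alpha> * \<alpha> - 1))"
      have "ssf_mult scale b \<alpha> t t' = (scale (p + q) e, p * \<alpha> + q * (\<alpha> - 2), p * (\<alpha> + 1) + q * (\<alpha> - 1))"
        unfolding t line prod.inject p_def q_def by (intro conjI arg_cong2[of _ _ _ _ scale] refl; algebra)
      also have "\<dots> = ssf_scale scale (2 * p) a + (scale q e, q * (\<alpha> - 2), q * (\<alpha> - 1))"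
        using two by (simp add: a ssf_scale_def E.scale_left_distrib)
      finally show ?thesis
        using ZI[OF refl refl] by blast
    qed
    show "ssf_mult scale b \<alpha> z h \<in> H" if "z \<in> Z" "h \<in> H" for z h
      using that(1) unfolding Z_def by (elim imageE) (simp only: orthH that(2))
    show "ssf_mult scale b \<alpha> t h \<in> H" if "t \<in> T" "h \<in> H" for t h
      using that(1) unfolding T_def by (elim imageE) (simp only: orthH that(2))
    show "\<exists>p. \<exists>z\<in>Z. \<exists>t\<in>T. ssf_mult scale b \<alpha> h h' = ssf_scale scale p a + z + t"
      if "h \<in> H" "h' \<in> H" for h h'
      \<comment> \<open>The product is a multiple of \<open>z\<close>, which has no component in \<open>E\<close>.\<close>
      using that span[of 0] by (auto simp: H_def ssf_mult_expand[OF bD(1)])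
  qed
qed

theorem theorem2:
  fixes scale :: "'f::field \<Rightarrow> 'e::ab_group_add \<Rightarrow> 'e"
    and b :: "'e \<Rightarrow> 'e \<Rightarrow> 'f"
    and \<alpha> :: 'f
  assumes "vector_space scale"
    and "symmetric_bilinear_form scale b"
    and "\<alpha> \<noteq> 0" and "\<alpha> \<noteq> 1" and "2 * \<alpha> \<noteq> 1"
  shows "(jordan_axis (ssf_scale scale) (ssf_mult scale b \<alpha>) \<alpha> ssf_z1 \<and>
          primitive (ssf_scale scale) (ssf_mult scale b \<alpha>) ssf_z1 \<and>
          jordan_axis (ssf_scale scale) (ssf_mult scale b \<alpha>) (1 - \<alpha>) ssf_z2 \<and>
          primitive (ssf_scale scale) (ssf_mult scale b \<alpha>) ssf_z2) \<and>
         (CHAR('f) \<noteq> 2 \<longrightarrow>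
          (\<forall>e. b e e = 1 \<longrightarrow>
            (let a = ssf_scale scale (1 / 2)
                       (ssf_emb e + ssf_scale scale \<alpha> ssf_z1 + ssf_scale scale (\<alpha> + 1) ssf_z2)
             in monster_axis (ssf_scale scale) (ssf_mult scale b \<alpha>) \<alpha> (1 / 2) a \<and>
                primitive (ssf_scale scale) (ssf_mult scale b \<alpha>) a) \<and>
            (let a = ssf_scale scale (1 / 2)
                       (ssf_emb e + ssf_scale scale (2 - \<alpha>) ssf_z1 + ssf_scale scale (1 - \<alpha>) ssf_z2)
             in monster_axis (ssf_scale scale) (ssf_mult scale b \<alpha>) (1 - \<alpha>) (1 / 2) a \<and>
                primitive (ssf_scale scale) (ssf_mult scale b \<alpha>) a)))"
proof -
  interpret E: vector_space scale by (fact assms(1))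
  let ?s = "ssf_scale scale" and ?m = "ssf_mult scale b \<alpha>" and ?m' = "ssf_mult scale b (1 - \<alpha>)"
  note b = assms(2)
  have \<alpha>': "1 - \<alpha> \<noteq> 0" "1 - \<alpha> \<noteq> 1" "2 * (1 - \<alpha>) \<noteq> 1"
    using assms(3-5) by (auto simp: algebra_simps)
  note swap = bij_ssf_swap ssf_swap_add ssf_swap_scale ssf_swap_mult[OF assms(1)]
  note axis_swap = fusion_axis_iso[of ?s ?m ssf_swap ?s ?m', OF ssf_algebra[OF b] swap]
  note primitive_swap = primitive_iso[of ssf_swap ?s ?s ?m' ?m, OF swap(1,3,4)]
  have z: "ssf_swap ssf_z1 = (ssf_z2 :: 'e \<times> 'f \<times> 'f)"
    by (simp add: ssf_swap_def ssf_z1_def ssf_z2_def)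
  have z1: "jordan_axis ?s ?m \<alpha> ssf_z1 \<and> primitive ?s ?m ssf_z1"
    using ssf_z1_primitive_jordan_axis[OF b assms(3,4)] .
  have jordan_swap: "jordan_axis ?s ?m \<gamma> (ssf_swap a)" if "jordan_axis ?s ?m' \<gamma> a" for \<gamma> a
    using that axis_swap[of _ _ a] unfolding jordan_axis_def by blast
  have monster_swap: "monster_axis ?s ?m \<gamma> \<delta> (ssf_swap a)" if "monster_axis ?s ?m' \<gamma> \<delta> a" for \<gamma> \<delta> a
    using that axis_swap[of _ _ a] unfolding monster_axis_def by blast
  have z2: "jordan_axis ?s ?m (1 - \<alpha>) ssf_z2 \<and> primitive ?s ?m ssf_z2"
    using ssf_z1_primitive_jordan_axis[OF b \<alpha>'(1,2)]
      jordan_swap[of _ ssf_z1] primitive_swap[of ssf_z1]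
    unfolding z by blast
  have families:
    "(let a = ?s (1 / 2) (ssf_emb e + ?s \<alpha> ssf_z1 + ?s (\<alpha> + 1) ssf_z2)
      in monster_axis ?s ?m \<alpha> (1 / 2) a \<and> primitive ?s ?m a) \<and>
     (let a = ?s (1 / 2) (ssf_emb e + ?s (2 - \<alpha>) ssf_z1 + ?s (1 - \<alpha>) ssf_z2)
      in monster_axis ?s ?m (1 - \<alpha>) (1 / 2) a \<and> primitive ?s ?m a)"
    if char: "CHAR('f) \<noteq> 2" and e: "b e e = 1" for e
  proof -
    have two: "(2::'f) \<noteq> 0"
    proof
      assume "(2::'f) = 0"
      then have "CHAR('f) dvd 2"
        by (simp flip: of_nat_eq_0_iff_char_dvd)
      then have "CHAR('f) \<le> 2" "CHAR('f) \<noteq> 0"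
        using dvd_imp_le[of "CHAR('f)" 2] dvd_0_left_iff[of "2::nat"] by fastforce+
      then show False
        using char CHAR_not_1'[where 'a = 'f] by linarith
    qed
    let ?a' = "?s (1 / 2) (ssf_emb e + ?s (1 - \<alpha>) ssf_z1 + ?s ((1 - \<alpha>) + 1) ssf_z2)"
    have a': "ssf_swap ?a' = ?s (1 / 2) (ssf_emb e + ?s (2 - \<alpha>) ssf_z1 + ?s (1 - \<alpha>) ssf_z2)"
      by (simp add: ssf_swap_def ssf_scale_def ssf_emb_def ssf_z1_def ssf_z2_def)
    have "monster_axis ?s ?m' (1 - \<alpha>) (1 / 2) ?a' \<and> primitive ?s ?m' ?a'"
      by (rule ssf_family_a_primitive_monster_axis[OF b \<alpha>' two e])
    then have "monster_axis ?s ?m (1 - \<alpha>) (1 / 2) (ssf_swap ?a') \<and> primitive ?s ?m (ssf_swap ?a')"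
      using monster_swap[of _ _ ?a'] primitive_swap[of ?a'] by blast
    then show ?thesis
      using ssf_family_a_primitive_monster_axis[OF b assms(3-5) two e]
      unfolding a' Let_def by blast
  qed
  show ?thesis
    using z1 z2 families by blast
qed

end
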